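(* Let $V=[n]$, $k\ge1$, $\varepsilon\in(0,1)$, positive integers $B_1,\dots,B_k$ with $B=\sum_{i\in[k]}B_i\le n$, and let $F:(k+1)^V\to\mathbb{R}_{\ge0}$ be $\varepsilon$-approximately $k$-submodular. Let $\mathbf{x}$ be the output of $k$-Greedy-IS applied to $F$ and $B_1,\dots,B_k$. Then $F(\mathbf{x})\ge\frac{(1-\varepsilon)^2}{(3-3\varepsilon+2\varepsilon B)(1+\varepsilon)}\max\{F(\mathbf{y}):\mathbf{y}\in(k+1)^V,\ |\mathrm{supp}_i(\mathbf{y})|\le B_i\ \forall i\in[k]\}$.
   Context: $(k+1)^V$ is the set of $k$-tuples $\mathbf{x}=(X_1,\dots,X_k)$ of pairwise disjoint subsets of $V$ (identified with $\mathbf{x}\in\{0,\dots,k\}^V$, $\mathbf{x}(e)=i\iff e\in X_i$); $\mathbf{0}$ is the all-empty tuple; $\mathrm{supp}(\mathbf{x})=\bigcup_iX_i$, $\mathrm{supp}_i(\mathbf{x})=X_i$; $\mathbf{x}\preceq\mathbf{y}$ iff $X_i\subseteq Y_i$ $\forall i$; $\Delta_{u,i}g(\mathbf{x})=g(X_1,\dots,X_i\cup\{u\},\dots,X_k)-g(\mathbf{x})$ for $u\notin\mathrm{supp}(\mathbf{x})$. $f$ is $k$-submodular if $\Delta_{u,i}f(\mathbf{x})\ge\Delta_{u,i}f(\mathbf{y})$ for $\mathbf{x}\preceq\mathbf{y}$, $u\notin\mathrm{supp}(\mathbf{y})$, and $\Delta_{u,i}f(\mathbf{x})+\Delta_{u,j}f(\mathbf{x})\ge0$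 for $i\ne j$; monotone if $\mathbf{x}\preceq\mathbf{y}\Rightarrow f(\mathbf{x})\le f(\mathbf{y})$. $F$ is $\varepsilon$-approximately $k$-submodular if there is a monotone $k$-submodular $f$ with $(1-\varepsilon)f(\mathbf{x})\le F(\mathbf{x})\le(1+\varepsilon)f(\mathbf{x})$ for all $\mathbf{x}$; $F(\mathbf{0})=f(\mathbf{0})=0$. $k$-Greedy-IS: start with $\mathbf{x}=\mathbf{0}$, $I=[k]$; while $I\ne\emptyset$: pick $(e,i)\in\arg\max_{e\in V\setminus\mathrm{supp}(\mathbf{x}),\,i\in I}\Delta_{e,i}F(\mathbf{x})$ (ties arbitrary), set $\mathbf{x}(e)=i$, and if $|\mathrm{supp}_i(\mathbf{x})|=B_i$ remove $i$ from $I$; output $\mathbf{x}$. *)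

theory Defs
  imports "HOL-Analysis.Analysis"
begin

text \<open>The ground set is \<open>{1..n}\<close>. A \<open>k\<close>-tuple of pairwise disjoint subsets
  \<open>(X\<^sub>1, \<dots>, X\<^sub>k)\<close> of it is represented by the function sending \<open>e\<close> to the index \<open>i\<close> with
  \<open>e \<in> X\<^sub>i\<close>, or to \<open>0\<close> if there is none. Values outside the ground set are fixed to \<open>0\<close>, so that
  equality of functions is equality of tuples.\<close>

definition ktuples :: "nat \<Rightarrow> nat \<Rightarrow> (nat \<Rightarrow> nat) set" where
  "ktuples n k = {x. (\<forall>e\<in>{1..n}. x e \<le> k) \<and> (\<forall>e. e \<notin> {1..n} \<longrightarrow> x e = 0)}"

definition empty_tuple :: "nat \<Rightarrow> nat" where
  "empty_tuple = (\<lambda>_. 0)"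

text \<open>Only used for \<open>i \<ge> 1\<close>.\<close>

definition supp_at :: "nat \<Rightarrow> (nat \<Rightarrow> nat) \<Rightarrow> nat set" where
  "supp_at i x = {e. x e = i}"

definition supp :: "nat \<Rightarrow> (nat \<Rightarrow> nat) \<Rightarrow> nat set" where
  "supp k x = (\<Union>i\<in>{1..k}. supp_at i x)"

definition tuple_le :: "nat \<Rightarrow> (nat \<Rightarrow> nat) \<Rightarrow> (nat \<Rightarrow> nat) \<Rightarrow> bool" where
  "tuple_le k x y \<longleftrightarrow> (\<forall>i\<in>{1..k}. supp_at i x \<subseteq> supp_at i y)"

text \<open>Only used for \<open>u \<notin> supp k x\<close>, where \<open>x(u := i)\<close> replaces \<open>X\<^sub>i\<close> by \<open>X\<^sub>i \<union> {u}\<close> and leaves the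
  other components unchanged.\<close>

definition marginal :: "((nat \<Rightarrow> nat) \<Rightarrow> real) \<Rightarrow> nat \<Rightarrow> nat \<Rightarrow> (nat \<Rightarrow> nat) \<Rightarrow> real" where
  "marginal g u i x = g (x(u := i)) - g x"

definition k_submodular :: "nat \<Rightarrow> nat \<Rightarrow> ((nat \<Rightarrow> nat) \<Rightarrow> real) \<Rightarrow> bool" where
  "k_submodular n k f \<longleftrightarrow>
     (\<forall>x\<in>ktuples n k. \<forall>y\<in>ktuples n k. \<forall>u\<in>{1..n} - supp k y. \<forall>i\<in>{1..k}.
        tuple_le k x y \<longrightarrow> marginal f u i x \<ge> marginal f u i y) \<and>
     (\<forall>x\<in>ktuples n k. \<forall>u\<in>{1..n} - supp k x. \<forall>i\<in>{1..k}. \<forall>j\<in>{1..k}.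
        i \<noteq> j \<longrightarrow> marginal f u i x + marginal f u j x \<ge> 0)"

definition k_monotone :: "nat \<Rightarrow> nat \<Rightarrow> ((nat \<Rightarrow> nat) \<Rightarrow> real) \<Rightarrow> bool" where
  "k_monotone n k f \<longleftrightarrow>
     (\<forall>x\<in>ktuples n k. \<forall>y\<in>ktuples n k. tuple_le k x y \<longrightarrow> f x \<le> f y)"

definition approx_k_submodular :: "real \<Rightarrow> nat \<Rightarrow> nat \<Rightarrow> ((nat \<Rightarrow> nat) \<Rightarrow> real) \<Rightarrow> bool" where
  "approx_k_submodular \<epsilon> n k F \<longleftrightarrow>
     F empty_tuple = 0 \<and>
     (\<exists>f. k_monotone n k f \<and> k_submodular n k f \<and> f empty_tuple = 0 \<and>
          (\<forall>x\<in>ktuples n k. (1 - \<epsilon>) * f x \<le> F x \<and> F x \<le> (1 + \<epsilon>) * f x))"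

text \<open>The pairs \<open>(x, I)\<close> that occur at the head of the greedy loop in some run; arbitrary
  tie-breaking makes this a relation rather than a function.\<close>

inductive greedy_IS_state ::
  "nat \<Rightarrow> nat \<Rightarrow> (nat \<Rightarrow> nat) \<Rightarrow> ((nat \<Rightarrow> nat) \<Rightarrow> real) \<Rightarrow> (nat \<Rightarrow> nat) \<Rightarrow> nat set \<Rightarrow> bool"
  for n k B F where
  init: "greedy_IS_state n k B F empty_tuple {1..k}"
| step: "greedy_IS_state n k B F x I \<Longrightarrow> I \<noteq> {} \<Longrightarrow>
    is_arg_max (\<lambda>(e, i). marginal F e i x) (\<lambda>(e, i). e \<in> {1..n} - supp k x \<and> i \<in> I) (e, i) \<Longrightarrow>
    x' = x(e := i) \<Longrightarrow>
    I' = (if card (supp_at i x') = B i then I - {i} else I) \<Longrightarrow>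
    greedy_IS_state n k B F x' I'"

definition greedy_IS_output ::
  "nat \<Rightarrow> nat \<Rightarrow> (nat \<Rightarrow> nat) \<Rightarrow> ((nat \<Rightarrow> nat) \<Rightarrow> real) \<Rightarrow> (nat \<Rightarrow> nat) \<Rightarrow> bool" where
  "greedy_IS_output n k B F x \<longleftrightarrow> greedy_IS_state n k B F x {}"

definition feasible :: "nat \<Rightarrow> nat \<Rightarrow> (nat \<Rightarrow> nat) \<Rightarrow> (nat \<Rightarrow> nat) set" where
  "feasible n k B = {y \<in> ktuples n k. \<forall>i\<in>{1..k}. card (supp_at i y) \<le> B i}"

text \<open>The maximum over the feasible tuples is taken over a finite nonempty set.\<close>

lemma finite_ktuples: "finite (ktuples n k)"
proof -
  have "ktuples n k = {x. \<forall>e. (e \<in> {1..n} \<longrightarrow> x e \<in> {..k}) \<and> (e \<notin> {1..n} \<longrightarrow> x e = 0)}"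
    by (auto simp: ktuples_def)
  then show ?thesis
    by (simp only: finite_set_of_finite_funs finite_atLeastAtMost finite_atMost)
qed

lemma finite_feasible: "finite (feasible n k B)"
  by (rule finite_subset[OF _ finite_ktuples[of n k]]) (auto simp: feasible_def)

lemma empty_tuple_feasible: "empty_tuple \<in> feasible n k B"
proof -
  have "supp_at i empty_tuple = {}" if "i \<in> {1..k}" for i
    using that by (auto simp: supp_at_def empty_tuple_def)
  moreover have "empty_tuple \<in> ktuples n k"
    by (auto simp: ktuples_def empty_tuple_def)
  ultimately show ?thesis
    by (simp add: feasible_def)
qed

end

theory Submission
  imports Defs
begin

text \<open>Fix a feasible tuple \<open>y\<close>. Along the run, keep a set \<open>R\<close> of not yet charged elements of
  \<open>supp y\<close> outside \<open>supp x\<close>, with at most \<open>B i - |supp\<^sub>i x|\<close> elements of each colour \<open>i\<close>, so that each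
  colour occurring in \<open>R\<close> is still available. When the greedy algorithm inserts \<open>(e, i)\<close>, charge to
  this step and drop from \<open>R\<close> the element \<open>e\<close>, if it is in \<open>R\<close>, and one element of \<open>R\<close> of colour \<open>i\<close>,
  if the capacity bound requires it. By diminishing returns and the greedy choice, each charge costs
  at most \<open>f x' - f x + 2\<epsilon>/(1-\<epsilon>) f x'\<close>. A step receives at most two charges, so the terms
  \<open>f x' - f x\<close> telescope to at most \<open>2 f x\<close>; but each element of \<open>y\<close> is charged only once, so that the
  error term occurs at most \<open>B\<close> times, not \<open>2 B\<close> times.\<close>

section \<open>Tuples, one-element extensions and monotone functions\<close>

lemma mem_supp_iff: "x \<in> ktuples n k \<Longrightarrow> e \<in> supp k x \<longleftrightarrow> x e \<noteq> 0"
  unfolding ktuples_def supp_def supp_at_def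
  by (cases "e \<in> {1..n}") auto

lemma ktuples_le: "x \<in> ktuples n k \<Longrightarrow> x e \<le> k"
  by (cases "e \<in> {1..n}") (auto simp: ktuples_def)

lemma ktuples_zero: "x \<in> ktuples n k \<Longrightarrow> e \<notin> {1..n} \<Longrightarrow> x e = 0"
  by (auto simp: ktuples_def)

lemma ktuples_upd: "x \<in> ktuples n k \<Longrightarrow> u \<in> {1..n} \<Longrightarrow> i \<le> k \<Longrightarrow> x(u := i) \<in> ktuples n k"
  by (auto simp: ktuples_def)

lemma ktuples_override_on:
  "x \<in> ktuples n k \<Longrightarrow> y \<in> ktuples n k \<Longrightarrow> override_on x y R \<in> ktuples n k"
  by (auto simp: ktuples_def override_on_def)

lemma finite_supp_at: "x \<in> ktuples n k \<Longrightarrow> i \<ge> 1 \<Longrightarrow> finite (supp_at i x)"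
  by (rule finite_subset[of _ "{1..n}"]) (use ktuples_zero[of x n k] in \<open>force simp: supp_at_def\<close>)+

lemma card_supp_at_upd:
  assumes "x \<in> ktuples n k" "x e = 0" "i \<ge> 1" "c \<ge> 1"
  shows "card (supp_at c (x(e := i))) = card (supp_at c x) + (if c = i then 1 else 0)"
proof (cases "c = i")
  case True
  have "supp_at i (x(e := i)) = insert e (supp_at i x)" "e \<notin> supp_at i x"
    using assms by (auto simp: supp_at_def)
  with True show ?thesis using finite_supp_at assms by simp
next
  case False
  then have "supp_at c (x(e := i)) = supp_at c x" using assms by (auto simp: supp_at_def)
  with False show ?thesis by simp
qed

lemma tuple_leI: "(\<And>e. x e \<noteq> 0 \<Longrightarrow> y e = x e) \<Longrightarrow> tuple_le k x y"
  by (auto simp: tuple_le_def supp_at_def)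

lemma k_monotone_le_upd:
  assumes "k_monotone n k f" "x \<in> ktuples n k" "u \<in> {1..n}" "x u = 0" "i \<le> k"
  shows "f x \<le> f (x(u := i))"
proof -
  have "tuple_le k x (x(u := i))" by (rule tuple_leI) (use assms in auto)
  with assms show ?thesis using ktuples_upd unfolding k_monotone_def by blast
qed

lemma k_monotone_nonneg:
  assumes "k_monotone n k f" "f empty_tuple = 0" "x \<in> ktuples n k"
  shows "0 \<le> f x"
proof -
  have "empty_tuple \<in> ktuples n k" using empty_tuple_feasible by (auto simp: feasible_def)
  moreover have "tuple_le k empty_tuple x" by (rule tuple_leI) (simp add: empty_tuple_def)
  ultimately show ?thesis using assms unfolding k_monotone_def by metis
qed

section \<open>Diminishing returns and the approximation error\<close>

text \<open>The elements of \<open>C\<close> are added one at a time to the tuple that takes only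
  \<open>R - C\<close> from \<open>y\<close>. Every intermediate tuple extends \<open>x\<close>, so
  diminishing returns bound each gain by the marginal at \<open>x\<close> itself.\<close>

lemma override_on_le_sum_marginal:
  assumes sub: "k_submodular n k f" and x: "x \<in> ktuples n k" and y: "y \<in> ktuples n k"
    and R: "\<And>u. u \<in> R \<Longrightarrow> x u = 0 \<and> y u \<noteq> 0"
    and "finite C" "C \<subseteq> R"
  shows "f (override_on x y R) \<le> f (override_on x y (R - C)) + (\<Sum>u\<in>C. marginal f u (y u) x)"
  using \<open>finite C\<close> \<open>C \<subseteq> R\<close>
proof (induction C rule: finite_induct)
  case (insert u C)
  define h where "h = override_on x y (R - insert u C)"
  have u: "u \<in> R" "u \<notin> C" using insert by auto
  have h: "h \<in> ktuples n k" unfolding h_def by (intro ktuples_override_on x y)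
  have "u \<in> {1..n}" using ktuples_zero[OF y] R[OF u(1)] by metis
  moreover have "u \<notin> supp k h"
    unfolding mem_supp_iff[OF h] using R u by (simp add: h_def override_on_def)
  moreover have "y u \<in> {1..k}" using ktuples_le[OF y, of u] R[OF u(1)] by simp
  moreover have "tuple_le k x h"
    by (rule tuple_leI) (use R in \<open>auto simp: h_def override_on_def\<close>)
  ultimately have "marginal f u (y u) h \<le> marginal f u (y u) x"
    using sub x h unfolding k_submodular_def by blast
  moreover have "h(u := y u) = override_on x y (R - C)"
    using u by (auto simp: h_def override_on_def)
  ultimately show ?case
    using insert unfolding h_def[symmetric] by (simp add: marginal_def)
qed simp

text \<open>Cancelling \<open>F x\<close> turns the greedy choice into a comparison of values of
  \<open>F\<close>. Passing from \<open>F\<close> to \<open>f\<close> costs the factor \<open>(1 +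
  \<epsilon>) / (1 - \<epsilon>) = 1 + 2 * \<epsilon> / (1 - \<epsilon>)\<close>, so the error is
  proportional to the value of \<open>f\<close>, not to its increment.\<close>

lemma greedy_marginal_bound:
  fixes \<epsilon> :: real
  assumes \<epsilon>: "0 < \<epsilon>" "\<epsilon> < 1"
    and apx: "\<forall>x\<in>ktuples n k. (1 - \<epsilon>) * f x \<le> F x \<and> F x \<le> (1 + \<epsilon>) * f x"
    and mem: "x(u := c) \<in> ktuples n k" "x(e := i) \<in> ktuples n k"
    and le: "marginal F u c x \<le> marginal F e i x"
  shows "marginal f u c x \<le> marginal f e i x + 2 * \<epsilon> / (1 - \<epsilon>) * f (x(e := i))"
proof -
  have "(1 - \<epsilon>) * f (x(u := c)) \<le> (1 + \<epsilon>) * f (x(e := i))"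
    using bspec[OF apx mem(1)] bspec[OF apx mem(2)] le unfolding marginal_def by linarith
  then have "f (x(u := c)) \<le> f (x(e := i)) + 2 * \<epsilon> / (1 - \<epsilon>) * f (x(e := i))"
    using \<epsilon> by (simp add: field_simps)
  then show ?thesis by (simp add: marginal_def)
qed

section \<open>Reachable states of the greedy loop\<close>

text \<open>Describes \<open>I\<close> by the capacities still open, so that termination with
  \<open>I = {}\<close> means that every colour is saturated.\<close>

lemma greedy_IS_state_invariant:
  assumes "greedy_IS_state n k B F x I" and B: "\<forall>i\<in>{1..k}. B i \<ge> 1"
  shows "x \<in> ktuples n k \<and> I = {i \<in> {1..k}. card (supp_at i x) < B i} \<and>
    (\<forall>i\<in>{1..k}. card (supp_at i x) \<le> B i)"
  using assms(1)
proof induction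
  case init
  have "card (supp_at i empty_tuple) = 0" if "i \<in> {1..k}" for i
    using that by (simp add: supp_at_def empty_tuple_def)
  with B show ?case
    using empty_tuple_feasible[of n k B] by (force simp: feasible_def)
next
  case (step x I e i x' I')
  have x: "x \<in> ktuples n k" and i: "i \<in> {1..k}" "card (supp_at i x) < B i"
    and e: "e \<in> {1..n}" "x e = 0"
    using step mem_supp_iff[of x n k e] by (auto simp: is_arg_max_def)
  have x': "x' \<in> ktuples n k" using x e i step by (simp add: ktuples_upd)
  have upd: "card (supp_at c x') = card (supp_at c x) + (if c = i then 1 else 0)"
    if "c \<in> {1..k}" for c
    using card_supp_at_upd[OF x e(2)] i that step(4) by simp
  then have le: "\<forall>c\<in>{1..k}. card (supp_at c x') \<le> B c"
    using step.IH i by simp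
  have I: "c \<in> I \<longleftrightarrow> c \<in> {1..k} \<and> card (supp_at c x) < B c" for c
    using step.IH by simp
  \<comment> \<open>The equality test of the algorithm agrees with the strict inequality: the count
    of colour \<open>i\<close> was below \<open>B i\<close> and rises by exactly one, while the
    other counts stay.\<close>
  have "c \<in> I' \<longleftrightarrow> c \<in> {1..k} \<and> card (supp_at c x') < B c" for c
    using upd[of c] upd[of i] I[of c] i le step(5) by (cases "c = i") auto
  then have "I' = {c \<in> {1..k}. card (supp_at c x') < B c}" by auto
  with x' le show ?case by simp
qed

section \<open>The charging argument\<close>

text \<open>Here \<open>m c\<close> stands for the number of elements of colour \<open>c\<close> in
  \<open>x\<close> before the step. Discarding one element of colour \<open>i\<close> from
  \<open>R\<close> makes up for the capacity that the step consumes.\<close>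

lemma exists_charged_set:
  fixes y :: "nat \<Rightarrow> nat"
  assumes "finite R" and cap: "\<And>c. c \<in> {1..k} \<Longrightarrow> card {u\<in>R. y u = c} + m c \<le> B c"
    and i: "i \<in> {1..k}" "m i < B i"
  obtains C where "C \<subseteq> R" "card C \<le> 2" "e \<in> R \<Longrightarrow> e \<in> C"
    "\<And>c. c \<in> {1..k} \<Longrightarrow> card {u\<in>R - C. y u = c} + (m c + (if c = i then 1 else 0)) \<le> B c"
proof -
  \<comment> \<open>\<open>D\<close> removes the inserted element, and \<open>E\<close> below
    removes one element of colour \<open>i\<close> if there is any; both may be empty or coincide,
    hence the bound 2.\<close>
  define D where "D = R \<inter> {e}"
  obtain E where E: "E \<subseteq> {u\<in>R. y u = i}" "card E \<le> 1" "{u\<in>R. y u = i} \<noteq> {} \<Longrightarrow> E \<noteq> {}"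
  proof (cases "{u\<in>R. y u = i} = {}")
    case False
    then obtain v where "v \<in> {u\<in>R. y u = i}" by blast
    then show ?thesis by (intro that[of "{v}"]) auto
  qed (use that[of "{}"] in auto)
  have "card (D \<union> E) \<le> 2"
    using card_Un_le[of D E] E(2) card_mono[of "{e}" D] by (simp add: D_def)
  moreover have "card {u\<in>R - (D \<union> E). y u = c} + (m c + (if c = i then 1 else 0)) \<le> B c"
    if c: "c \<in> {1..k}" for c
  proof (cases "c = i \<and> {u\<in>R. y u = i} \<noteq> {}")
    case True
    then have "{u\<in>R - (D \<union> E). y u = c} \<subset> {u\<in>R. y u = c}"
      using E by blast
    then have "card {u\<in>R - (D \<union> E). y u = c} < card {u\<in>R. y u = c}"
      using \<open>finite R\<close> by (intro psubset_card_mono) auto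
    with cap[OF c] True show ?thesis by simp
  next
    case False
    have "card {u\<in>R - (D \<union> E). y u = c} \<le> card {u\<in>R. y u = c}"
      using \<open>finite R\<close> by (intro card_mono) auto
    \<comment> \<open>If \<open>R\<close> has nothing of colour \<open>i\<close>, no element has to
      be given up: \<open>m i < B i\<close> already leaves room for the new one.\<close>
    moreover have "card {u\<in>R. y u = c} = 0" if "c = i"
    proof -
      have "{u\<in>R. y u = c} = {}" using False that by simp
      then show ?thesis by (simp only: card.empty)
    qed
    ultimately show ?thesis using cap[OF c] i by (cases "c = i") auto
  qed
  ultimately show ?thesis
    using E(1) by (intro that[of "D \<union> E"]) (auto simp: D_def)
qed

text \<open>The elements of \<open>S - R\<close> are those already charged. Their errors are all
  measured at the current value \<open>f x\<close>, which never decreases along the run; the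
  coefficient 2 comes from the telescoped increments.\<close>

lemma greedy_IS_charging:
  fixes \<epsilon> :: real and y :: "nat \<Rightarrow> nat"
  defines "\<delta> \<equiv> 2 * \<epsilon> / (1 - \<epsilon>)" and "S \<equiv> {u. y u \<noteq> 0}"
  assumes state: "greedy_IS_state n k B F x I"
    and \<epsilon>: "0 < \<epsilon>" "\<epsilon> < 1" and B: "\<forall>i\<in>{1..k}. B i \<ge> 1"
    and mono: "k_monotone n k f" and sub: "k_submodular n k f" and f0: "f empty_tuple = 0"
    and apx: "\<forall>x\<in>ktuples n k. (1 - \<epsilon>) * f x \<le> F x \<and> F x \<le> (1 + \<epsilon>) * f x"
    and feas: "y \<in> feasible n k B"
  shows "\<exists>R. R \<subseteq> S \<and> (\<forall>u\<in>R. x u = 0) \<and>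
    (\<forall>c\<in>{1..k}. card {u\<in>R. y u = c} + card (supp_at c x) \<le> B c) \<and>
    f y \<le> f (override_on x y R) + (2 + \<delta> * real (card (S - R))) * f x"
  using state
proof induction
  case init
  have "override_on empty_tuple y S = y"
    by (auto simp: override_on_def S_def empty_tuple_def)
  moreover have "{u\<in>S. y u = c} = supp_at c y" "supp_at c empty_tuple = {}"
    if "c \<in> {1..k}" for c
    using that by (auto simp: S_def supp_at_def empty_tuple_def)
  ultimately show ?case
    using feas f0 by (intro exI[of _ S]) (simp add: feasible_def empty_tuple_def)
next
  case (step x I e i x' I')
  have y: "y \<in> ktuples n k" using feas by (simp add: feasible_def)
  have SV: "S \<subseteq> {1..n}" using ktuples_zero[OF y] unfolding S_def by (metis (mono_tags) mem_Collect_eq subsetI)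
  then have finS: "finite S" by (rule finite_subset) simp
  have x: "x \<in> ktuples n k" and I: "I = {i \<in> {1..k}. card (supp_at i x) < B i}"
    using greedy_IS_state_invariant[OF step(1) B] by auto
  have i: "i \<in> {1..k}" "card (supp_at i x) < B i" and e: "e \<in> {1..n}" "x e = 0"
    using step(3) I mem_supp_iff[OF x, of e] by (auto simp: is_arg_max_def)
  have x': "x' \<in> ktuples n k" using x e i step by (simp add: ktuples_upd)
  have greedy: "marginal F u c x \<le> marginal F e i x"
    if "u \<in> {1..n}" "x u = 0" "c \<in> I" for u c
  proof -
    have "u \<notin> supp k x" using mem_supp_iff[OF x, of u] that by simp
    with that step(3) show ?thesis by (auto simp: is_arg_max_def not_less)
  qed
  obtain R where R: "R \<subseteq> S" "\<forall>u\<in>R. x u = 0"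
      and cap: "\<And>c. c \<in> {1..k} \<Longrightarrow> card {u\<in>R. y u = c} + card (supp_at c x) \<le> B c"
      and bound: "f y \<le> f (override_on x y R) + (2 + \<delta> * real (card (S - R))) * f x"
    using step.IH by blast
  have finR: "finite R" using R(1) finS by (rule finite_subset)
  obtain C where C: "C \<subseteq> R" "card C \<le> 2" "e \<in> R \<Longrightarrow> e \<in> C"
    and cap': "\<And>c. c \<in> {1..k} \<Longrightarrow>
      card {u\<in>R - C. y u = c} + (card (supp_at c x) + (if c = i then 1 else 0)) \<le> B c"
    using exists_charged_set[where R = R and y = y and m = "\<lambda>c. card (supp_at c x)" and e = e,
        OF finR cap i] by blast
  have finC: "finite C" using C(1) finR by (rule finite_subset)
  have "marginal f u (y u) x \<le> f x' - f x + \<delta> * f x'" if "u \<in> C" for u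
  proof -
    have u: "u \<in> R" "u \<in> {1..n}" "x u = 0" "y u \<noteq> 0"
    proof -
      show "u \<in> R" using that C(1) by blast
      then have "u \<in> S" using R(1) by blast
      then show "u \<in> {1..n}" "y u \<noteq> 0" using SV by (blast, simp add: S_def)
      show "x u = 0" using \<open>u \<in> R\<close> R(2) by blast
    qed
    have yu: "y u \<in> {1..k}" using ktuples_le[OF y, of u] u by simp
    \<comment> \<open>Since \<open>u\<close> itself occupies one of the places reserved in
      \<open>cap\<close>, its colour is not saturated, and \<open>(u, y u)\<close> was a candidate
      for the greedy choice.\<close>
    have "card {v\<in>R. y v = y u} > 0" using u finR by (auto simp: card_gt_0_iff)
    with cap[OF yu] yu have "y u \<in> I" by (simp add: I)
    with greedy_marginal_bound[OF \<epsilon> apx, of x u "y u" e i] greedy u yu x x' step(4)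
    show ?thesis by (simp add: \<delta>_def ktuples_upd marginal_def)
  qed
  then have "(\<Sum>u\<in>C. marginal f u (y u) x) \<le> real (card C) * (f x' - f x + \<delta> * f x')"
    by (rule sum_bounded_above)
  moreover have "f (override_on x y R) \<le>
      f (override_on x y (R - C)) + (\<Sum>u\<in>C. marginal f u (y u) x)"
    by (rule override_on_le_sum_marginal[OF sub x y _ finC C(1)]) (use R in \<open>auto simp: S_def\<close>)
  moreover have "f (override_on x y (R - C)) \<le> f (override_on x' y (R - C))"
  proof -
    \<comment> \<open>As \<open>e\<close> is not in \<open>R - C\<close>, the greedy insertion is
      not overridden by \<open>y\<close>; it merely fills an empty place, and monotonicity
      applies.\<close>
    have "override_on x' y (R - C) = (override_on x y (R - C))(e := i)"
      using C(3) step(4) by (auto simp: override_on_def fun_eq_iff)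
    moreover have "override_on x y (R - C) e = 0"
      using C(3) e by (auto simp: override_on_def)
    ultimately show ?thesis
      using k_monotone_le_upd[OF mono ktuples_override_on[OF x y] e(1)] i by simp
  qed
  moreover have fx: "0 \<le> f x" "f x \<le> f x'"
    using k_monotone_nonneg[OF mono f0 x] k_monotone_le_upd[OF mono x e] i step(4) by auto
  \<comment> \<open>The bound 2 on \<open>card C\<close> goes into the telescoping part alone. The
    error part keeps \<open>card C\<close> exactly, to be absorbed into the growth of
    \<open>card (S - R)\<close>.\<close>
  moreover have "real (card C) * (f x' - f x) \<le> 2 * (f x' - f x)"
    using C(2) fx by (intro mult_right_mono) auto
  moreover have "\<delta> * real (card (S - R)) * f x \<le> \<delta> * real (card (S - R)) * f x'"
    using fx \<epsilon> by (intro mult_left_mono) (auto simp: \<delta>_def)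
  moreover have "card (S - (R - C)) = card (S - R) + card C"
  proof -
    have "S - (R - C) = (S - R) \<union> C" using C R by auto
    moreover have "card ((S - R) \<union> C) = card (S - R) + card C"
      using C finS finC by (intro card_Un_disjoint) auto
    ultimately show ?thesis by simp
  qed
  ultimately have "f y \<le> f (override_on x' y (R - C)) +
      (2 + \<delta> * real (card (S - (R - C)))) * f x'"
    using bound by (simp add: algebra_simps)
  moreover have "card (supp_at c x') = card (supp_at c x) + (if c = i then 1 else 0)"
    if "c \<in> {1..k}" for c
    using card_supp_at_upd[OF x e(2)] i that step(4) by simp
  moreover have "R - C \<subseteq> S" "\<forall>u\<in>R - C. x' u = 0"
    using R C(3) step(4) by auto
  ultimately show ?case
    using cap' by (intro exI[of _ "R - C"] conjI ballI) auto
qed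

section \<open>The approximation ratio\<close>

lemma card_supp_le:
  assumes "y \<in> feasible n k B"
  shows "card {u. y u \<noteq> 0} \<le> (\<Sum>i=1..k. B i)"
proof -
  have y: "y \<in> ktuples n k" using assms by (simp add: feasible_def)
  have "{u. y u \<noteq> 0} = (\<Union>i\<in>{1..k}. supp_at i y)"
    using mem_supp_iff[OF y] unfolding supp_def by blast
  then have "card {u. y u \<noteq> 0} \<le> (\<Sum>i=1..k. card (supp_at i y))"
    using card_UN_le[of "{1..k}" "\<lambda>i. supp_at i y"] by simp
  also have "\<dots> \<le> (\<Sum>i=1..k. B i)"
    using assms by (intro sum_mono) (simp add: feasible_def)
  finally show ?thesis .
qed

theorem theorem6:
  fixes n k :: nat
    and \<epsilon> :: real
    and B :: "nat \<Rightarrow> nat"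
    and F :: "(nat \<Rightarrow> nat) \<Rightarrow> real"
    and x :: "nat \<Rightarrow> nat"
  assumes "k \<ge> 1"
    and "0 < \<epsilon>" and "\<epsilon> < 1"
    and "\<forall>i\<in>{1..k}. B i \<ge> 1"
    and "(\<Sum>i=1..k. B i) \<le> n"
    and "\<forall>y\<in>ktuples n k. F y \<ge> 0"
    and "approx_k_submodular \<epsilon> n k F"
    and "greedy_IS_output n k B F x"
  shows "F x \<ge> (1 - \<epsilon>)^2 / ((3 - 3 * \<epsilon> + 2 * \<epsilon> * real (\<Sum>i=1..k. B i)) * (1 + \<epsilon>))
               * Max (F ` feasible n k B)"
proof -
  define b where "b = real (\<Sum>i=1..k. B i)"
  define \<delta> where "\<delta> = 2 * \<epsilon> / (1 - \<epsilon>)"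
  note \<epsilon> = \<open>0 < \<epsilon>\<close> \<open>\<epsilon> < 1\<close>
  obtain f where mono: "k_monotone n k f" and sub: "k_submodular n k f"
    and f0: "f empty_tuple = 0"
    and apx: "\<forall>x\<in>ktuples n k. (1 - \<epsilon>) * f x \<le> F x \<and> F x \<le> (1 + \<epsilon>) * f x"
    using assms(7) unfolding approx_k_submodular_def by blast
  have "Max (F ` feasible n k B) \<in> F ` feasible n k B"
    using finite_feasible empty_tuple_feasible[of n k B] by (intro Max_in) auto
  then obtain y where feas: "y \<in> feasible n k B" and max: "Max (F ` feasible n k B) = F y"
    by auto
  have y: "y \<in> ktuples n k" using feas by (simp add: feasible_def)
  have state: "greedy_IS_state n k B F x {}"
    using assms(8) by (simp add: greedy_IS_output_def)
  have x: "x \<in> ktuples n k" and "{c \<in> {1..k}. card (supp_at c x) < B c} = {}"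
    using greedy_IS_state_invariant[OF state assms(4)] by auto
  then have full: "B c \<le> card (supp_at c x)" if "c \<in> {1..k}" for c
    using that by (metis (mono_tags, lifting) empty_iff mem_Collect_eq not_less)
  obtain R where R: "R \<subseteq> {u. y u \<noteq> 0}"
    and cap: "\<And>c. c \<in> {1..k} \<Longrightarrow> card {u\<in>R. y u = c} + card (supp_at c x) \<le> B c"
    and bound: "f y \<le> f (override_on x y R) + (2 + \<delta> * real (card ({u. y u \<noteq> 0} - R))) * f x"
    using greedy_IS_charging[OF state \<epsilon> assms(4) mono sub f0 apx feas] unfolding \<delta>_def by blast
  \<comment> \<open>In the final state all colours are saturated, so \<open>cap\<close> leaves no
    room for an uncharged element.\<close>
  have "R = {}"
  proof (rule ccontr)
    assume "R \<noteq> {}"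
    then obtain u where u: "u \<in> R" by blast
    have "R \<subseteq> {1..n}" using R ktuples_zero[OF y] by (metis (mono_tags) mem_Collect_eq subset_iff)
    then have "finite R" by (rule finite_subset) simp
    with u have "card {v\<in>R. y v = y u} > 0" by (auto simp: card_gt_0_iff)
    moreover have "y u \<in> {1..k}" using u R ktuples_le[OF y, of u] by auto
    ultimately show False using cap[of "y u"] full[of "y u"] by simp
  qed
  have fx: "0 \<le> f x" by (rule k_monotone_nonneg[OF mono f0 x])
  \<comment> \<open>With \<open>R = {}\<close> the overridden tuple is \<open>x\<close> itself,
    whose value raises the coefficient from 2 to 3.\<close>
  have "f y \<le> (3 + \<delta> * real (card {u. y u \<noteq> 0})) * f x"
    using bound \<open>R = {}\<close> by (simp add: algebra_simps)
  also have "\<dots> \<le> (3 + \<delta> * b) * f x"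
    unfolding b_def using card_supp_le[OF feas] fx \<epsilon>
    by (intro mult_right_mono add_left_mono mult_left_mono) (auto simp: \<delta>_def simp del: of_nat_sum)
  also have "\<dots> = (3 - 3 * \<epsilon> + 2 * \<epsilon> * b) / (1 - \<epsilon>) * f x"
    using \<epsilon> by (simp add: \<delta>_def field_simps)
  finally have fy: "f y \<le> (3 - 3 * \<epsilon> + 2 * \<epsilon> * b) / (1 - \<epsilon>) * f x" .
  define c where "c = 3 - 3 * \<epsilon> + 2 * \<epsilon> * b"
  have c: "c > 0" unfolding c_def using \<epsilon> by (intro add_pos_nonneg) (auto simp: b_def sum_nonneg)
  \<comment> \<open>One factor \<open>1 - \<epsilon>\<close> clears the denominator of
    \<open>\<delta>\<close>; the other turns \<open>f x\<close> into the lower bound for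
    \<open>F x\<close>.\<close>
  have "(1 - \<epsilon>)\<^sup>2 * F y \<le> (1 - \<epsilon>)\<^sup>2 * ((1 + \<epsilon>) * f y)"
    using apx y by (intro mult_left_mono) auto
  also have "\<dots> \<le> (1 - \<epsilon>)\<^sup>2 * ((1 + \<epsilon>) * (c / (1 - \<epsilon>) * f x))"
    using fy \<epsilon> unfolding c_def by (intro mult_left_mono) auto
  also have "\<dots> = c * (1 + \<epsilon>) * ((1 - \<epsilon>) * f x)"
    using \<epsilon> by (simp add: power2_eq_square)
  also have "\<dots> \<le> c * (1 + \<epsilon>) * F x"
    using apx x c \<epsilon> by (intro mult_left_mono) auto
  finally have "(1 - \<epsilon>)\<^sup>2 / (c * (1 + \<epsilon>)) * F y \<le> F x"
    using c \<epsilon> by (simp add: divide_le_eq mult.commute)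
  then show ?thesis unfolding max c_def b_def .
qed

end
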